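(* Let $q=p^e>4$, where $p$ is a prime, and let $\ell$ be a positive integer with $2\ell\mid e$. For every integer $k$ with $3\le k\le1+\frac{q-1}{p^\ell+1}$ and every integer $h$ with $0\le h\le k-2$, there exists a $[q+2,k,q-k+2]_q$ AMDS code $C$ with $\dim(\operatorname{Hull}_\ell(C))=h$. These codes are also NMDS.
   Context: For $0\le\ell\le e-1$, the $\ell$-Galois inner product on $\mathbb F_q^N$ is $\langle\boldsymbol x,\boldsymbol y\rangle_\ell=\sum_i x_iy_i^{p^\ell}$; for a linear code $C\subseteq\mathbb F_q^N$, $C^{\perp_\ell}=\{\boldsymbol x:\langle\boldsymbol c,\boldsymbol x\rangle_\ell=0\ \forall\boldsymbol c\in C\}$ and $\operatorname{Hull}_\ell(C)=C\cap C^{\perp_\ell}$. An $[N,k,d]_q$ code is a $k$-dimensional subspace of $\mathbb F_q^N$ with minimum Hamming distance $d$; it is AMDS if $d=N-k$, and NMDS if both it and its Euclidean dual are AMDS. *)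

theory Defs
  imports "HOL-Analysis.Analysis" "HOL-Computational_Algebra.Primes"
begin

text \<open>
  Linear codes of length \<open>N\<close> over the finite field \<open>'a\<close> are subspaces of \<open>'a ^ 'n\<close> with
  \<open>CARD('n) = N\<close>; dimension is \<^const>\<open>vec.dim\<close>, the dimension over \<open>'a\<close>.
\<close>

definition hamming_dist :: "'a ^ 'n::finite \<Rightarrow> 'a ^ 'n \<Rightarrow> nat" where
  "hamming_dist x y = card {i. x $ i \<noteq> y $ i}"

text \<open>Unspecified (\<open>Min {}\<close>) if the code has fewer than two words.\<close>

definition min_dist :: "('a ^ 'n::finite) set \<Rightarrow> nat" where
  "min_dist C = Min {hamming_dist x y | x y. x \<in> C \<and> y \<in> C \<and> x \<noteq> y}"

definition is_linear_code :: "('a::field ^ 'n::finite) set \<Rightarrow> nat \<Rightarrow> nat \<Rightarrow> nat \<Rightarrow> bool" where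
  "is_linear_code C N k d \<longleftrightarrow>
     CARD('n) = N \<and> vec.subspace C \<and> vec.dim C = k \<and> min_dist C = d"

definition euclidean_dual :: "('a::field ^ 'n::finite) set \<Rightarrow> ('a ^ 'n) set" where
  "euclidean_dual C = {x. \<forall>c\<in>C. (\<Sum>i\<in>UNIV. c $ i * x $ i) = 0}"

text \<open>The parameter \<open>p\<close> is meant to be the characteristic of \<open>'a\<close>.\<close>

definition galois_inner :: "nat \<Rightarrow> nat \<Rightarrow> 'a::field ^ 'n::finite \<Rightarrow> 'a ^ 'n \<Rightarrow> 'a" where
  "galois_inner p l x y = (\<Sum>i\<in>UNIV. x $ i * (y $ i) ^ (p ^ l))"

definition galois_dual :: "nat \<Rightarrow> nat \<Rightarrow> ('a::field ^ 'n::finite) set \<Rightarrow> ('a ^ 'n) set" where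
  "galois_dual p l C = {x. \<forall>c\<in>C. galois_inner p l c x = 0}"

definition galois_hull :: "nat \<Rightarrow> nat \<Rightarrow> ('a::field ^ 'n::finite) set \<Rightarrow> ('a ^ 'n) set" where
  "galois_hull p l C = C \<inter> galois_dual p l C"

definition AMDS :: "('a::field ^ 'n::finite) set \<Rightarrow> bool" where
  "AMDS C \<longleftrightarrow> (\<exists>k d. is_linear_code C CARD('n) k d \<and> int d = int CARD('n) - int k)"

definition NMDS :: "('a::field ^ 'n::finite) set \<Rightarrow> bool" where
  "NMDS C \<longleftrightarrow> AMDS C \<and> AMDS (euclidean_dual C)"

lemma galois_dual_0: "galois_dual p 0 C = euclidean_dual C"
  by (simp add: galois_dual_def galois_inner_def euclidean_dual_def)

end

theory Submission
  imports Defs "HOL-Computational_Algebra.Polynomial"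
begin

text \<open>
  Let \<open>P = p\<^sup>l\<close>. Evaluate the polynomials \<open>f\<close> of degree below \<open>k\<close> at all points of the field and
  at infinity (the coefficient \<open>f\<^bsub>k-1\<^esub>\<close>), and append the functional \<open>f\<^bsub>k-2\<^esub> + c f\<^bsub>k-1\<^esub>\<close>, a point on
  the tangent at infinity of the normal rational curve. This point lies in no span of \<open>k - 2\<close> points
  of the curve, but choosing \<open>c\<close> to be the sum of \<open>k - 1\<close> distinct field elements puts it in the
  span of these \<open>k - 1\<close> points; so both the code and its dual are AMDS.

  Since \<open>(k - 1)(P + 1) \<le> q - 1\<close>, the sum of \<open>g f\<^sup>P\<close> over the field involves only the leading
  coefficients, so the Galois form of the unscaled code has rank at most two. Scaling \<open>k - 2 - h\<close>
  finite points \<open>T\<close> and infinity by some \<open>b\<close> with \<open>b\<^bsup>P+1\<^esup> \<noteq> 1\<close> makes the hull the set of \<open>f\<close>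
  of degree below \<open>k - 2\<close> that vanish on \<open>T\<close>. Such a \<open>b\<close> exists because \<open>P\<^sup>2 \<le> q\<close> and \<open>q > 4\<close>
  give \<open>P + 1 < q - 1\<close>.
\<close>

section \<open>Polynomials over a field\<close>

text \<open>Coefficients instead of \<open>degree f < n\<close>, because \<open>degree 0 = 0\<close>
  would exclude the zero polynomial for \<open>n = 0\<close>. This form is a subspace for every
  \<open>n\<close>.\<close>

definition polys_below :: "nat \<Rightarrow> 'a::comm_ring_1 poly set" where
  "polys_below n = {f. \<forall>i\<ge>n. coeff f i = 0}"

lemma polys_belowD: "f \<in> polys_below n \<Longrightarrow> n \<le> i \<Longrightarrow> coeff f i = 0"
  by (simp add: polys_below_def)

lemma polys_below_mono: "f \<in> polys_below m \<Longrightarrow> m \<le> n \<Longrightarrow> f \<in> polys_below n"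
  by (auto simp: polys_below_def)

lemma polys_below_0: "0 \<in> polys_below n"
  by (simp add: polys_below_def)

lemma polys_below_add: "f \<in> polys_below n \<Longrightarrow> g \<in> polys_below n \<Longrightarrow> f + g \<in> polys_below n"
  by (simp add: polys_below_def)

lemma polys_below_diff: "f \<in> polys_below n \<Longrightarrow> g \<in> polys_below n \<Longrightarrow> f - g \<in> polys_below n"
  by (simp add: polys_below_def)

lemma polys_below_smult: "f \<in> polys_below n \<Longrightarrow> smult a f \<in> polys_below n"
  by (simp add: polys_below_def)

lemma polys_below_sum: "(\<And>i. i \<in> I \<Longrightarrow> f i \<in> polys_below n) \<Longrightarrow> sum f I \<in> polys_below n"
  by (simp add: polys_below_def coeff_sum)

lemma degree_less_if_polys_below:
  assumes "f \<in> polys_below n" "f \<noteq> 0"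
  shows "degree f < n"
  using assms by (metis leading_coeff_neq_0 not_le polys_belowD)

lemma polys_below_iff_degree: "f \<in> polys_below (Suc n) \<longleftrightarrow> degree f \<le> n"
  using degree_less_if_polys_below[of f "Suc n"]
  by (cases "f = 0") (auto simp: polys_below_def coeff_eq_0)

lemma card_roots_less_if_polys_below:
  fixes f :: "'a::field poly"
  assumes "f \<in> polys_below n" "f \<noteq> 0"
  shows "card {x. poly f x = 0} < n"
  using card_poly_roots_bound[OF assms(2)] degree_less_if_polys_below[OF assms] by linarith

lemma polys_below_eq_0:
  fixes f :: "'a::field poly"
  assumes "f \<in> polys_below n" "n \<le> card A" "\<And>a. a \<in> A \<Longrightarrow> poly f a = 0"
  shows "f = 0"
proof (rule ccontr)
  assume "f \<noteq> 0"
  then have "card A \<le> card {x. poly f x = 0}"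
    by (intro card_mono poly_roots_finite) (use assms in auto)
  with card_roots_less_if_polys_below[OF assms(1) \<open>f \<noteq> 0\<close>] assms(2) show False by linarith
qed

definition root_poly :: "'a::field set \<Rightarrow> 'a poly" where
  "root_poly A = (\<Prod>a\<in>A. [:- a, 1:])"

lemma poly_root_poly_eq_0_iff: "finite A \<Longrightarrow> poly (root_poly A) x = 0 \<longleftrightarrow> x \<in> A"
  by (auto simp: root_poly_def poly_prod)

lemma degree_root_poly: "degree (root_poly A) = card A"
  by (cases "finite A") (simp_all add: root_poly_def degree_prod_sum_eq)

lemma coeff_root_poly_card: "coeff (root_poly A) (card A) = 1"
  using lead_coeff_prod[of "\<lambda>a. [:- a, 1:]" A]
  by (simp add: degree_root_poly flip: root_poly_def)

lemma root_poly_in_polys_below: "card A < n \<Longrightarrow> root_poly A \<in> polys_below n"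
  by (simp add: polys_below_def coeff_eq_0 degree_root_poly)

text \<open>A power of X fills up the degree of \<open>root_poly A\<close> to exactly
  \<open>n\<close>; the product stays monic.\<close>

lemma exists_monic_vanishing:
  fixes A :: "'a::field set"
  assumes "finite A" "card A \<le> n"
  obtains f where "f \<in> polys_below (Suc n)" "coeff f n = 1" "\<And>a. a \<in> A \<Longrightarrow> poly f a = 0"
proof
  let ?f = "monom 1 (n - card A) * root_poly A"
  show "?f \<in> polys_below (Suc n)"
    unfolding polys_below_iff_degree
    using degree_mult_le[of "monom 1 (n - card A)" "root_poly A"] assms(2)
      degree_monom_le[of "1::'a" "n - card A"]
    by (simp add: degree_root_poly)
  show "coeff ?f n = 1"
    using assms(2) coeff_root_poly_card[of A] by (simp add: coeff_monom_mult)
  show "poly ?f a = 0" if "a \<in> A" for a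
    using assms(1) that by (simp add: poly_root_poly_eq_0_iff)
qed

section \<open>Lagrange interpolation\<close>

definition lagrange_basis :: "'a::field set \<Rightarrow> 'a \<Rightarrow> 'a poly" where
  "lagrange_basis A a = smult (inverse (poly (root_poly (A - {a})) a)) (root_poly (A - {a}))"

lemma poly_lagrange_basis:
  assumes "finite A" "x \<in> A"
  shows "poly (lagrange_basis A a) x = (if x = a then 1 else 0)"
  using assms poly_root_poly_eq_0_iff[of "A - {a}"] by (auto simp: lagrange_basis_def)

lemma lagrange_basis_in_polys_below:
  assumes "finite A" "a \<in> A"
  shows "lagrange_basis A a \<in> polys_below (card A)"
  unfolding lagrange_basis_def
  by (intro polys_below_smult root_poly_in_polys_below) (rule card_Diff1_less[OF assms])

lemma poly_lagrange_sum:
  assumes "finite A" "x \<in> A"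
  shows "poly (\<Sum>a\<in>A. smult (y a) (lagrange_basis A a)) x = y x"
proof -
  have "poly (\<Sum>a\<in>A. smult (y a) (lagrange_basis A a)) x = (\<Sum>a\<in>A. if x = a then y a else 0)"
    unfolding poly_sum by (intro sum.cong) (simp_all add: poly_lagrange_basis assms)
  then show ?thesis using assms by simp
qed

lemma lagrange_sum_in_polys_below:
  "finite A \<Longrightarrow> (\<Sum>a\<in>A. smult (y a) (lagrange_basis A a)) \<in> polys_below (card A)"
  by (intro polys_below_sum polys_below_smult lagrange_basis_in_polys_below)

lemma lagrange_expansion:
  assumes "finite A" "f \<in> polys_below (card A)"
  shows "(\<Sum>a\<in>A. smult (poly f a) (lagrange_basis A a)) = f"
proof -
  have "(\<Sum>a\<in>A. smult (poly f a) (lagrange_basis A a)) - f = 0"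
    by (rule polys_below_eq_0[where A = A and n = "card A"])
      (simp_all add: polys_below_diff lagrange_sum_in_polys_below poly_lagrange_sum assms)
  then show ?thesis by simp
qed

section \<open>Coefficients of products and powers at a degree bound\<close>

lemma coeff_mult_top:
  fixes f g :: "'a::comm_ring_1 poly"
  assumes "degree f \<le> m" "degree g \<le> n"
  shows "coeff (f * g) (m + n) = coeff f m * coeff g n"
proof -
  have "coeff (f * g) (m + n) = (\<Sum>i\<le>m+n. coeff f i * coeff g (m + n - i))"
    by (rule coeff_mult)
  also have "\<dots> = (\<Sum>i\<in>{m}. coeff f i * coeff g (m + n - i))"
  proof (rule sum.mono_neutral_right)
    show "\<forall>i\<in>{..m + n} - {m}. coeff f i * coeff g (m + n - i) = 0"
    proof
      fix i assume "i \<in> {..m + n} - {m}"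
      then have "m < i \<or> n < m + n - i" by auto
      then show "coeff f i * coeff g (m + n - i) = 0"
        using assms by (auto simp: coeff_eq_0)
    qed
  qed auto
  finally show ?thesis by simp
qed

text \<open>With a bound in place of the exact degree, the formula also covers polynomials whose
  coefficient at \<open>m\<close> is zero. It is applied with \<open>m = k - 1\<close> to arbitrary
  message polynomials.\<close>

lemma coeff_power_top:
  fixes f :: "'a::comm_ring_1 poly"
  assumes "degree f \<le> m"
  shows "coeff (f ^ n) (m * n) = coeff f m ^ n"
proof (induction n)
  case (Suc n)
  have "degree (f ^ n) \<le> m * n"
    using degree_power_le[of f n] assms by (meson le_trans mult_le_mono1)
  from coeff_mult_top[OF assms this] Suc show ?case by (simp add: algebra_simps)
qed simp


section \<open>Power sums over a finite field\<close>

lemma card_complement: "card (- A) = CARD('a) - card A" for A :: "'a::finite set"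
  by (simp add: Compl_eq_Diff_UNIV card_Diff_subset)

text \<open>Translation by 1 permutes the field, yet adds \<open>CARD('a)\<close> to the sum of all
  elements.\<close>

lemma of_nat_CARD_eq_0: "of_nat CARD('a) = (0 :: 'a::{field,finite})"
proof -
  have "(\<Sum>x\<in>UNIV. x + 1) = (\<Sum>x\<in>UNIV. x :: 'a)"
    by (rule sum.reindex_bij_betw) (rule bij_plus_right)
  then show ?thesis by (simp add: sum.distrib)
qed

lemma bij_betw_mult_nonzero:
  fixes a :: "'a::field"
  assumes "a \<noteq> 0"
  shows "bij_betw ((*) a) (- {0}) (- {0})"
  by (rule bij_betw_byWitness[where f' = "(*) (inverse a)"]) (use assms in auto)

text \<open>Multiplication by \<open>a\<close> permutes the nonzero elements, so it preserves their
  product, which can be cancelled.\<close>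

lemma power_CARD_minus_1:
  fixes a :: "'a::{field,finite}"
  assumes "a \<noteq> 0"
  shows "a ^ (CARD('a) - 1) = 1"
proof -
  have "(\<Prod>x\<in>-{0}. a * x) = (\<Prod>x\<in>-{0}. x)"
    by (rule prod.reindex_bij_betw) (rule bij_betw_mult_nonzero[OF assms])
  moreover have "(\<Prod>x\<in>-{0::'a}. x) \<noteq> 0" by simp
  ultimately show ?thesis
    by (simp add: prod.distrib card_complement)
qed

text \<open>The polynomial X^n - 1 has at most \<open>n\<close> roots, fewer than there are nonzero
  elements.\<close>

lemma exists_power_neq_1:
  assumes "0 < n" "n < CARD('a) - 1"
  obtains a :: "'a::{field,finite}" where "a \<noteq> 0" "a ^ n \<noteq> 1"
proof -
  let ?f = "monom 1 n - 1 :: 'a poly"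
  have "coeff ?f n = 1" using assms(1) by simp
  then have nz: "?f \<noteq> 0" by (metis coeff_0 zero_neq_one)
  have "degree ?f \<le> n"
    using degree_diff_le_max[of "monom 1 n" "1 :: 'a poly"] by (simp add: degree_monom_eq)
  with card_poly_roots_bound[OF nz] have *: "card {x. poly ?f x = 0} \<le> n" by linarith
  show thesis
  proof (rule ccontr)
    assume "\<not> thesis"
    with that have "- {0} \<subseteq> {x. poly ?f x = 0}" by (auto simp: poly_monom)
    then have "card (- {0::'a}) \<le> card {x. poly ?f x = 0}" by (intro card_mono) auto
    with * assms(2) show False by (simp add: card_complement)
  qed
qed

text \<open>For \<open>n\<close> strictly between 0 and q - 1, substituting \<open>a * x\<close>
  with \<open>a ^ n \<noteq> 1\<close> multiplies the sum by \<open>a ^ n\<close> without changing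
  it. For \<open>n = 0\<close> all terms are 1, including \<open>0 ^ 0\<close>, and the sum is q =
  0.\<close>

lemma sum_power_UNIV:
  assumes "n \<le> CARD('a) - 1"
  shows "(\<Sum>x\<in>UNIV. x ^ n :: 'a::{field,finite}) = (if n = CARD('a) - 1 then - 1 else 0)"
proof -
  have two: "CARD('a) \<ge> 2"
    using card_mono[of UNIV "{0, 1 :: 'a}"] by simp
  consider "n = 0" | "n = CARD('a) - 1" | "0 < n" "n < CARD('a) - 1" using assms by linarith
  then show ?thesis
  proof cases
    case 1
    then show ?thesis using two by (simp add: of_nat_CARD_eq_0)
  next
    case 2
    have "(\<Sum>x\<in>UNIV. x ^ n :: 'a) = (\<Sum>x\<in>-{0}. x ^ n)"
      using 2 two by (intro sum.mono_neutral_right) (auto simp: power_0_left)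
    also have "\<dots> = (\<Sum>x\<in>-{0::'a}. 1)"
      using 2 by (intro sum.cong) (simp_all add: power_CARD_minus_1[simplified])
    also have "\<dots> = of_nat CARD('a) - 1"
      using two by (simp add: card_complement of_nat_diff)
    finally show ?thesis using 2 by (simp add: of_nat_CARD_eq_0)
  next
    case 3
    obtain a :: 'a where a: "a \<noteq> 0" "a ^ n \<noteq> 1" using exists_power_neq_1[OF 3] .
    have "(\<Sum>x\<in>UNIV. (a * x) ^ n) = (\<Sum>x\<in>UNIV. x ^ n)"
      by (rule sum.reindex_bij_betw)
        (rule bij_betw_byWitness[where f' = "(*) (inverse a)"], use a(1) in auto)
    then have "a ^ n * (\<Sum>x\<in>UNIV. x ^ n) = (\<Sum>x\<in>UNIV. x ^ n)"
      by (simp only: power_mult_distrib sum_distrib_left)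
    with a(2) 3 show ?thesis by simp
  qed
qed

text \<open>Summed over the field, only the monomial of degree q - 1 survives.\<close>

lemma sum_poly_UNIV:
  fixes f :: "'a::{field,finite} poly"
  assumes "degree f \<le> CARD('a) - 1"
  shows "(\<Sum>x\<in>UNIV. poly f x) = - coeff f (CARD('a) - 1)"
proof -
  let ?q = "CARD('a) - 1"
  have "poly f x = (\<Sum>i\<le>?q. coeff f i * x ^ i)" for x
    unfolding poly_altdef using assms by (intro sum.mono_neutral_left) (auto simp: coeff_eq_0)
  then have "(\<Sum>x\<in>UNIV. poly f x) = (\<Sum>i\<le>?q. coeff f i * (\<Sum>x\<in>UNIV. x ^ i))"
    by (simp add: sum.swap[of _ UNIV] sum_distrib_left)
  also have "\<dots> = (\<Sum>i\<le>?q. if i = ?q then - coeff f i else 0)"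
    by (intro sum.cong) (simp_all add: sum_power_UNIV)
  finally show ?thesis by simp
qed


section \<open>Dimension and minimum distance of linear codes\<close>

text \<open>The set \<open>J\<close> is an information set: restriction to \<open>J\<close> is a
  bijection from \<open>V\<close> onto all value assignments. Thus \<open>V\<close> is a complement
  of the space of vectors supported outside \<open>J\<close>.\<close>

lemma dim_information_set:
  fixes V :: "('a::field ^ 'n::finite) set"
  assumes V: "vec.subspace V"
    and inj: "\<And>x. x \<in> V \<Longrightarrow> \<forall>i\<in>J. x $ i = 0 \<Longrightarrow> x = 0"
    and surj: "\<And>y. \<exists>x\<in>V. \<forall>i\<in>J. x $ i = y $ i"
  shows "vec.dim V = card J"
proof -
  \<comment> \<open>The double complement matches the shape of \<open>dim_substandard_cart\<close>
    for the index set \<open>- J\<close>.\<close>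
  let ?W = "{x :: 'a ^ 'n. \<forall>i. i \<notin> - J \<longrightarrow> x $ i = 0}"
  have W: "vec.subspace ?W" by (auto simp: vec.subspace_def)
  have "V \<inter> ?W = {0}"
    using inj vec.subspace_0[OF V] by auto
  moreover have "{x + y |x y. x \<in> V \<and> y \<in> ?W} = UNIV"
  proof -
    have "z \<in> {x + y |x y. x \<in> V \<and> y \<in> ?W}" for z
    proof -
      obtain x where "x \<in> V" "\<forall>i\<in>J. x $ i = z $ i" using surj by blast
      then have "z = x + (z - x)" "x \<in> V" "z - x \<in> ?W" by auto
      then show ?thesis by blast
    qed
    then show ?thesis by blast
  qed
  ultimately have "CARD('n) = vec.dim V + card (- J)"
    using vec.dim_sums_Int[OF V W] dim_substandard_cart[where 'a = 'a and d = "- J"]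
    by (simp add: vec_dim_card card_cart_basis)
  then show ?thesis
    using card_mono[of UNIV J] by (simp add: card_complement)
qed

text \<open>In a subspace, the distance of two words is the weight of their difference, so it
  suffices to look at weights.\<close>

lemma min_dist_eqI:
  fixes C :: "('a::field ^ 'n::finite) set"
  assumes C: "vec.subspace C"
    and x: "x \<in> C" "x \<noteq> 0" "card {i. x $ i \<noteq> 0} \<le> d"
    and lb: "\<And>y. y \<in> C \<Longrightarrow> y \<noteq> 0 \<Longrightarrow> d \<le> card {i. y $ i \<noteq> 0}"
  shows "min_dist C = d"
  unfolding min_dist_def
proof (rule Min_eqI)
  have "{hamming_dist x y |x y. x \<in> C \<and> y \<in> C \<and> x \<noteq> y} \<subseteq> {..CARD('n)}"
    by (auto simp: hamming_dist_def intro!: card_mono)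
  then show "finite {hamming_dist x y |x y. x \<in> C \<and> y \<in> C \<and> x \<noteq> y}"
    by (rule finite_subset) simp
  show "d \<le> w" if "w \<in> {hamming_dist x y |x y. x \<in> C \<and> y \<in> C \<and> x \<noteq> y}" for w
  proof -
    from that obtain y z where "w = hamming_dist y z" "y \<in> C" "z \<in> C" "y \<noteq> z" by blast
    with lb[of "y - z"] vec.subspace_diff[OF C, of y z] show ?thesis
      by (simp add: hamming_dist_def)
  qed
  have "d = hamming_dist x 0"
    using x lb[OF x(1,2)] by (simp add: hamming_dist_def)
  with x vec.subspace_0[OF C]
  show "d \<in> {hamming_dist x y |x y. x \<in> C \<and> y \<in> C \<and> x \<noteq> y}" by blast
qed

lemma subspace_euclidean_dual: "vec.subspace (euclidean_dual C)"
  unfolding vec.subspace_def euclidean_dual_def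
  by (auto simp: algebra_simps sum.distrib simp flip: sum_distrib_left)

lemma sum_UNIV_option:
  "(\<Sum>z\<in>UNIV. F z) = F None + (\<Sum>x\<in>UNIV. F (Some x))" for F :: "'c::finite option \<Rightarrow> _"
  by (simp add: UNIV_option_conv sum.reindex)


section \<open>The code of the normal rational curve and a point on a tangent\<close>

text \<open>The bijection \<open>\<phi>\<close> labels the q + 2 coordinates: \<open>None\<close> is
  the point on the tangent, \<open>Some None\<close> the point at infinity,
  \<open>Some (Some a)\<close> the curve point over \<open>a\<close>. The multipliers
  \<open>v\<close> and \<open>b\<close> scale the columns of the curve; the tangent column stays
  unscaled.\<close>

locale tangent_code =
  fixes \<phi> :: "'n::finite \<Rightarrow> 'a::{field,finite} option option"
    and v :: "'a \<Rightarrow> 'a" and b c :: 'a and k :: nat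
  assumes bij_\<phi>: "bij \<phi>" and v_nonzero: "\<And>a. v a \<noteq> 0" and b_nonzero: "b \<noteq> 0"
    and k_ge: "3 \<le> k" and k_le: "k \<le> CARD('a)"
begin

definition tangent :: "'a poly \<Rightarrow> 'a" where
  "tangent f = coeff f (k - 2) + c * coeff f (k - 1)"

fun col :: "'a option option \<Rightarrow> 'a poly \<Rightarrow> 'a" where
  "col None f = tangent f"
| "col (Some None) f = b * coeff f (k - 1)"
| "col (Some (Some a)) f = v a * poly f a"

definition enc :: "'a poly \<Rightarrow> 'a ^ 'n" where
  "enc f = (\<chi> i. col (\<phi> i) f)"

definition code :: "('a ^ 'n) set" where
  "code = enc ` polys_below k"

section \<open>Linearity of the encoding and relabelling of coordinates\<close>

lemma enc_nth [simp]: "enc f $ i = col (\<phi> i) f"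
  by (simp add: enc_def)

lemma tangent_add: "tangent (f + g) = tangent f + tangent g"
  by (simp add: tangent_def algebra_simps)

lemma tangent_smult: "tangent (smult s f) = s * tangent f"
  by (simp add: tangent_def algebra_simps)

lemma col_add: "col z (f + g) = col z f + col z g"
  by (cases "(z, f)" rule: col.cases) (simp_all add: tangent_add algebra_simps)

lemma col_smult: "col z (smult s f) = s * col z f"
  by (cases "(z, f)" rule: col.cases) (simp_all add: tangent_smult)

lemma col_0: "col z 0 = 0"
  using col_smult[of z 0 0] by simp

lemma col_sum: "col z (\<Sum>i\<in>I. f i) = (\<Sum>i\<in>I. col z (f i))"
  by (induction I rule: infinite_finite_induct) (simp_all add: col_0 col_add)

lemma enc_add: "enc (f + g) = enc f + enc g"
  by (simp add: vec_eq_iff col_add)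

lemma enc_smult: "enc (smult s f) = s *s enc f"
  by (simp add: vec_eq_iff col_smult)

lemma enc_0: "enc 0 = 0"
  by (simp add: vec_eq_iff col_0)

lemma all_positions: "(\<forall>i. Q (\<phi> i)) \<longleftrightarrow> Q None \<and> Q (Some None) \<and> (\<forall>a. Q (Some (Some a)))"
  using bij_\<phi> by (metis bij_pointE not_Some_eq)

lemma card_positions: "card {i. Q (\<phi> i)} = card {z. Q z}"
proof (rule bij_betw_same_card)
  show "bij_betw \<phi> {i. Q (\<phi> i)} {z. Q z}"
    using bij_\<phi> by (intro bij_betw_imageI) (auto simp: inj_def bij_def surj_def inj_on_def)
qed

lemma sum_positions:
  fixes F :: "'a option option \<Rightarrow> 'b::comm_monoid_add"
  shows "(\<Sum>i\<in>UNIV. F (\<phi> i)) = F None + F (Some None) + (\<Sum>a\<in>UNIV. F (Some (Some a)))"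
  using sum.reindex_bij_betw[OF bij_\<phi>, of F] by (simp add: sum_UNIV_option add.assoc)

lemma subspace_enc:
  assumes "0 \<in> F" "\<And>f g. f \<in> F \<Longrightarrow> g \<in> F \<Longrightarrow> f + g \<in> F" "\<And>s f. f \<in> F \<Longrightarrow> smult s f \<in> F"
  shows "vec.subspace (enc ` F)"
  unfolding vec.subspace_def
proof (intro conjI ballI allI)
  show "0 \<in> enc ` F" using assms(1) enc_0 by (metis imageI)
qed (use assms in \<open>auto simp flip: enc_add enc_smult\<close>)

lemma subspace_code: "vec.subspace code"
  unfolding code_def
  by (rule subspace_enc) (auto intro: polys_below_0 polys_below_add polys_below_smult)

section \<open>Independence of the column functionals\<close>

lemma evaluations_independent:
  fixes A :: "'a set"
  assumes "finite A" "card A \<le> k" "a \<in> A"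
    and "\<And>g. g \<in> polys_below k \<Longrightarrow> (\<Sum>a\<in>A. \<alpha> a * poly g a) = 0"
  shows "\<alpha> a = 0"
proof -
  \<comment> \<open>This test polynomial is 1 at \<open>a\<close> and 0 on the rest of
    \<open>A\<close>, so it isolates one coefficient.\<close>
  have "lagrange_basis A a \<in> polys_below k"
    using lagrange_basis_in_polys_below[OF assms(1,3)] assms(2) by (rule polys_below_mono)
  from assms(4)[OF this] have "(\<Sum>x\<in>A. \<alpha> x * (if x = a then 1 else 0)) = 0"
    using assms(1) by (simp add: poly_lagrange_basis cong: sum.cong)
  then show ?thesis using assms(1,3) by (simp add: if_distrib cong: if_cong)
qed

text \<open>A monic polynomial of degree \<open>k - 2\<close> separates the tangent functional from the point
  at infinity and any \<open>k - 2\<close> evaluations.\<close>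

lemma functionals_independent:
  fixes A :: "'a set"
  assumes A: "finite A" "card A \<le> k - 2"
    and eq: "\<And>g. g \<in> polys_below k \<Longrightarrow>
      \<gamma> * tangent g + \<beta> * coeff g (k - 1) + (\<Sum>a\<in>A. \<alpha> a * poly g a) = 0"
  shows "\<gamma> = 0" "\<beta> = 0" "a \<in> A \<Longrightarrow> \<alpha> a = 0"
proof -
  obtain f where f: "f \<in> polys_below (Suc (k - 2))" "coeff f (k - 2) = 1"
      "\<And>a. a \<in> A \<Longrightarrow> poly f a = 0"
    using exists_monic_vanishing[OF A] by metis
  have "f \<in> polys_below k" using f(1) k_ge by (auto intro: polys_below_mono)
  moreover have "coeff f (k - 1) = 0" using polys_belowD[OF f(1)] k_ge by simp
  ultimately show \<gamma>: "\<gamma> = 0" using eq[of f] f(2,3) by (simp add: tangent_def)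
  have "card A \<le> k - 1" using A(2) by simp
  \<comment> \<open>Once \<open>\<gamma>\<close> is gone, a monic polynomial of degree
    \<open>k - 1\<close> vanishing on \<open>A\<close> isolates \<open>\<beta>\<close>.\<close>
  then obtain g where g: "g \<in> polys_below (Suc (k - 1))" "coeff g (k - 1) = 1"
      "\<And>a. a \<in> A \<Longrightarrow> poly g a = 0"
    using exists_monic_vanishing[OF A(1)] by metis
  with eq[of g] \<gamma> k_ge show \<beta>: "\<beta> = 0" by simp
  show "\<alpha> a = 0" if "a \<in> A"
    by (rule evaluations_independent[OF A(1) _ that]) (use A(2) eq \<gamma> \<beta> in auto)
qed

section \<open>Dimension and minimum distance of the code\<close>

lemma card_col_zeros:
  assumes "f \<in> polys_below k" "f \<noteq> 0"
  shows "card {z. col z f = 0} \<le> k"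
proof -
  let ?R = "{a. poly f a = 0}"
  have R: "card (Some ` Some ` ?R) = card ?R" by (simp add: card_image)
  have fin: "finite (insert None (insert (Some None) (Some ` Some ` ?R)))" by simp
  \<comment> \<open>If the top coefficient vanishes, \<open>f\<close> has at most
    \<open>k - 2\<close> roots, which leaves room for both extra positions. Otherwise the position
    at infinity is nonzero, and at most \<open>k - 1\<close> roots and the tangent position
    remain.\<close>
  show ?thesis
  proof (cases "coeff f (k - 1) = 0")
    case True
    then have "coeff f i = 0" if "i \<ge> k - 1" for i
      using that polys_belowD[OF assms(1), of i] by (cases "i = k - 1") auto
    then have "f \<in> polys_below (k - 1)" by (simp add: polys_below_def)
    from card_roots_less_if_polys_below[OF this assms(2)] have "card ?R < k - 1" .
    moreover have "{z. col z f = 0} \<subseteq> insert None (insert (Some None) (Some ` Some ` ?R))"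
    proof
      fix z assume "z \<in> {z. col z f = 0}"
      then show "z \<in> insert None (insert (Some None) (Some ` Some ` ?R))"
        by (cases "(z, f)" rule: col.cases) (auto simp: v_nonzero)
    qed
    from card_mono[OF fin this]
    have "card {z. col z f = 0} \<le> Suc (Suc (card ?R))"
      using R by (simp add: card_insert_if split: if_splits)
    ultimately show ?thesis by linarith
  next
    case False
    have "{z. col z f = 0} \<subseteq> insert None (Some ` Some ` ?R)"
    proof
      fix z assume "z \<in> {z. col z f = 0}"
      then show "z \<in> insert None (Some ` Some ` ?R)"
        using False by (cases "(z, f)" rule: col.cases) (auto simp: v_nonzero b_nonzero)
    qed
    then have "card {z. col z f = 0} \<le> card (insert None (Some ` Some ` ?R))"
      by (intro card_mono) auto
    then have "card {z. col z f = 0} \<le> Suc (card ?R)"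
      using R by (simp add: card_insert_if split: if_splits)
    with card_roots_less_if_polys_below[OF assms] show ?thesis by linarith
  qed
qed

lemma weight_enc: "card {i. enc f $ i \<noteq> 0} = CARD('a) + 2 - card {z. col z f = 0}"
proof -
  have "card {i. enc f $ i \<noteq> 0} = card {z. col z f \<noteq> 0}"
    using card_positions[of "\<lambda>z. col z f \<noteq> 0"] by simp
  also have "{z. col z f \<noteq> 0} = - {z. col z f = 0}" by auto
  finally show ?thesis by (simp add: card_complement)
qed

text \<open>Any \<open>h\<close> points outside \<open>T\<close> form an information set: together
  with \<open>T\<close> they determine a polynomial of degree below \<open>card T + h\<close>, and
  interpolation reaches all values. Taking \<open>T\<close> empty gives the dimension of the code;
  nonempty \<open>T\<close> serves for the hull.\<close>

lemma dim_enc_vanishing: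
  assumes T: "card T + h \<le> CARD('a)"
    and F: "F = {f. f \<in> polys_below (card T + h) \<and> (\<forall>a\<in>T. poly f a = 0)}"
  shows "vec.dim (enc ` F) = h"
proof -
  have "h \<le> card (- T)" using T by (simp add: card_complement)
  then obtain B where B: "B \<subseteq> - T" "card B = h" "finite B" by (rule obtain_subset_with_card_n)
  have TB: "T \<inter> B = {}" "finite (T \<union> B)" "card (T \<union> B) = card T + h"
    using B card_Un_disjoint[of T B] by auto
  let ?J = "{i. \<phi> i \<in> Some ` Some ` B}"
  have J: "card ?J = h"
    using card_positions[of "\<lambda>z. z \<in> Some ` Some ` B"] by (simp add: card_image B(2))
  have "vec.dim (enc ` F) = card ?J"
  proof (rule dim_information_set)
    show "vec.subspace (enc ` F)"
      unfolding F by (rule subspace_enc) (auto intro: polys_below_0 polys_below_add polys_below_smult)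
    show "x = 0" if "x \<in> enc ` F" "\<forall>i\<in>?J. x $ i = 0" for x
    proof -
      from that(1) obtain f where f: "f \<in> F" "x = enc f" by blast
      have "\<forall>i. \<phi> i \<in> Some ` Some ` B \<longrightarrow> col (\<phi> i) f = 0"
        using that(2) f(2) by simp
      then have "poly f a = 0" if "a \<in> B" for a
        using all_positions[of "\<lambda>z. z \<in> Some ` Some ` B \<longrightarrow> col z f = 0"] that
        by (auto simp: v_nonzero)
      then have "f = 0"
        using f(1) F TB(3) by (intro polys_below_eq_0[of f "card T + h" "T \<union> B"]) auto
      then show ?thesis by (simp add: f(2) enc_0)
    qed
    show "\<exists>x\<in>enc ` F. \<forall>i\<in>?J. x $ i = y $ i" for y
    proof -
      define w where "w a = (if a \<in> B then y $ (inv \<phi> (Some (Some a))) / v a else 0)" for a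
      let ?f = "\<Sum>a\<in>T \<union> B. smult (w a) (lagrange_basis (T \<union> B) a)"
      have f: "poly ?f a = w a" if "a \<in> T \<union> B" for a
        using poly_lagrange_sum[OF TB(2) that] .
      have "?f \<in> polys_below (card T + h)"
        using lagrange_sum_in_polys_below[OF TB(2)] TB(3) by metis
      moreover have "\<forall>a\<in>T. poly ?f a = 0"
        using f TB(1) by (auto simp: w_def)
      ultimately have "?f \<in> F" by (simp only: F mem_Collect_eq)
      moreover have "enc ?f $ i = y $ i" if "i \<in> ?J" for i
      proof -
        from that obtain a where a: "a \<in> B" "\<phi> i = Some (Some a)" by auto
        then have "inv \<phi> (Some (Some a)) = i" using bij_\<phi> by (metis bij_is_inj inv_f_f)
        with a f[of a] show ?thesis by (simp only: enc_nth col.simps) (simp add: w_def v_nonzero)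
      qed
      ultimately show ?thesis by (intro bexI[of _ "enc ?f"]) auto
    qed
  qed
  then show ?thesis using J by simp
qed

lemma dim_code: "vec.dim code = k"
  unfolding code_def using dim_enc_vanishing[of "{}" k] k_le by simp

text \<open>The hypothesis on \<open>c\<close> says that \<^const>\<open>tangent\<close> kills \<^term>\<open>root_poly S\<close>.\<close>

lemma min_dist_code:
  assumes S: "card S = k - 1" and c: "c = - coeff (root_poly S) (k - 2)"
  shows "min_dist code = CARD('a) + 2 - k"
proof (rule min_dist_eqI[OF subspace_code])
  let ?g = "root_poly S"
  have g: "?g \<in> polys_below k" using root_poly_in_polys_below[of S k] S k_ge by simp
  have g1: "coeff ?g (k - 1) = 1" using coeff_root_poly_card[of S] S by simp
  show "enc ?g \<in> code" using g by (simp add: code_def)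
  have "col (Some None) ?g \<noteq> 0" using g1 b_nonzero by simp
  then show "enc ?g \<noteq> 0"
    using all_positions[of "\<lambda>z. col z ?g = 0"] by (auto simp: vec_eq_iff simp del: col.simps)
  have "tangent ?g = 0" unfolding tangent_def using g1 by (simp add: c)
  \<comment> \<open>The word of \<open>root_poly S\<close> attains the bound: it vanishes at the
    \<open>k - 1\<close> points of \<open>S\<close> and at the tangent position.\<close>
  then have "insert None (Some ` Some ` S) \<subseteq> {z. col z ?g = 0}"
    by (auto simp: poly_root_poly_eq_0_iff)
  then have "card (insert None (Some ` Some ` S)) \<le> card {z. col z ?g = 0}"
    by (intro card_mono) auto
  then have "k \<le> card {z. col z ?g = 0}"
    using S k_ge by (simp add: card_insert_if card_image image_iff split: if_splits)
  then show "card {i. enc ?g $ i \<noteq> 0} \<le> CARD('a) + 2 - k"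
    unfolding weight_enc by simp
  show "CARD('a) + 2 - k \<le> card {i. y $ i \<noteq> 0}" if "y \<in> code" "y \<noteq> 0" for y
  proof -
    from that obtain f where f: "y = enc f" "f \<in> polys_below k" "f \<noteq> 0"
      using enc_0 unfolding code_def by blast
    show ?thesis unfolding f(1) weight_enc using card_col_zeros[OF f(2,3)] by simp
  qed
qed

section \<open>The Galois form and the hull\<close>

lemma galois_inner_enc:
  assumes P: "P = p ^ l" and deg: "(k - 1) * (P + 1) \<le> CARD('a) - 1"
    and v: "\<And>a. v a ^ (P + 1) = (if a \<in> T then \<theta> else 1)" and b: "b ^ (P + 1) = \<theta>"
    and g: "g \<in> polys_below k" and f: "f \<in> polys_below k"
    and \<delta>: "\<delta> = (if (k - 1) * (P + 1) = CARD('a) - 1 then 1 else 0)"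
  shows "galois_inner p l (enc g) (enc f) =
    tangent f ^ P * tangent g + (\<theta> - \<delta>) * coeff f (k - 1) ^ P * coeff g (k - 1)
      + (\<Sum>a\<in>T. (\<theta> - 1) * poly f a ^ P * poly g a)"
proof -
  have k: "Suc (k - 1) = k" using k_ge by simp
  have dg: "degree g \<le> k - 1" and df: "degree f \<le> k - 1"
    using f g by (simp_all only: polys_below_iff_degree[symmetric] k)
  have dfP: "degree (f ^ P) \<le> (k - 1) * P"
    using degree_power_le[of f P] df by (meson le_trans mult_le_mono1)
  \<comment> \<open>Since the degree is at most q - 1, the power sum sees only the coefficient at q
    - 1; \<open>\<delta>\<close> records whether the bound \<open>(k - 1) * (P + 1)\<close> equals q
    - 1.\<close>
  have deg_gf: "degree (g * f ^ P) \<le> (k - 1) * (P + 1)"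
    using degree_mult_le[of g "f ^ P"] dg dfP by (simp only: distrib_left mult_1_right)
  have top: "coeff (g * f ^ P) ((k - 1) * (P + 1)) = coeff g (k - 1) * coeff f (k - 1) ^ P"
    using coeff_mult_top[OF dg dfP] coeff_power_top[OF df, of P]
    by (simp only: distrib_left mult_1_right add.commute)
  have "coeff (g * f ^ P) (CARD('a) - 1) = \<delta> * (coeff g (k - 1) * coeff f (k - 1) ^ P)"
  proof (cases "(k - 1) * (P + 1) = CARD('a) - 1")
    case True
    then show ?thesis using top \<delta> by simp
  next
    case False
    then have "degree (g * f ^ P) < CARD('a) - 1" using deg deg_gf by linarith
    then show ?thesis using False \<delta> by (simp add: coeff_eq_0)
  qed
  then have sum: "(\<Sum>a\<in>UNIV. poly g a * poly f a ^ P)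
      = - \<delta> * coeff f (k - 1) ^ P * coeff g (k - 1)"
    using sum_poly_UNIV[of "g * f ^ P"] deg deg_gf by (simp add: mult_ac)
  have "(\<Sum>a\<in>UNIV. v a * poly g a * (v a * poly f a) ^ P)
      = (\<Sum>a\<in>UNIV. v a ^ (P + 1) * (poly g a * poly f a ^ P))"
    by (simp add: power_mult_distrib mult_ac)
  \<comment> \<open>Each scaled point has weight \<open>\<theta>\<close>; splitting it as 1 plus the
    excess \<open>\<theta> - 1\<close> brings out the full power sum.\<close>
  also have "\<dots> = (\<Sum>a\<in>UNIV. poly g a * poly f a ^ P
      + (if a \<in> T then (\<theta> - 1) * poly f a ^ P * poly g a else 0))"
    unfolding v by (intro sum.cong) (auto simp: algebra_simps)
  also have "\<dots> = (\<Sum>a\<in>UNIV. poly g a * poly f a ^ P)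
      + (\<Sum>a\<in>T. (\<theta> - 1) * poly f a ^ P * poly g a)"
    by (simp add: sum.distrib flip: sum.inter_filter)
  finally have points: "(\<Sum>a\<in>UNIV. v a * poly g a * (v a * poly f a) ^ P) =
      (\<Sum>a\<in>UNIV. poly g a * poly f a ^ P) + (\<Sum>a\<in>T. (\<theta> - 1) * poly f a ^ P * poly g a)" .
  have infinity: "b * coeff g (k - 1) * (b * coeff f (k - 1)) ^ P
      = \<theta> * coeff f (k - 1) ^ P * coeff g (k - 1)"
    using b by (simp add: power_mult_distrib mult_ac)
  have "galois_inner p l (enc g) (enc f) = tangent g * tangent f ^ P
      + b * coeff g (k - 1) * (b * coeff f (k - 1)) ^ P
      + (\<Sum>a\<in>UNIV. v a * poly g a * (v a * poly f a) ^ P)"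
    using sum_positions[of "\<lambda>z. col z g * col z f ^ P"] by (simp add: galois_inner_def P)
  then show ?thesis unfolding points infinity sum by (simp add: algebra_simps)
qed

text \<open>As a functional of \<open>g\<close>, the form combines the tangent, the coefficient at
  infinity and the evaluations on \<open>T\<close>. These are independent, so the form vanishes
  identically only if each of their coefficients, a multiple of a \<open>P\<close>-th power
  depending on \<open>f\<close>, is zero.\<close>

lemma galois_hull_code:
  assumes P: "P = p ^ l" "0 < P" and deg: "(k - 1) * (P + 1) \<le> CARD('a) - 1"
    and v: "\<And>a. v a ^ (P + 1) = (if a \<in> T then \<theta> else 1)" and b: "b ^ (P + 1) = \<theta>"
    and \<theta>: "\<theta> \<noteq> 0" "\<theta> \<noteq> 1" and T: "card T \<le> k - 2"
  shows "galois_hull p l code = enc ` {f. f \<in> polys_below (k - 2) \<and> (\<forall>a\<in>T. poly f a = 0)}"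
    (is "_ = enc ` ?F")
proof -
  define \<delta> :: 'a where "\<delta> = (if (k - 1) * (P + 1) = CARD('a) - 1 then 1 else 0)"
  note inner = galois_inner_enc[OF P(1) deg v b _ _ \<delta>_def]
  have F: "?F \<subseteq> polys_below k" by (auto intro: polys_below_mono)
  have "(\<forall>g\<in>polys_below k. galois_inner p l (enc g) (enc f) = 0) \<longleftrightarrow> f \<in> ?F"
    if f: "f \<in> polys_below k" for f
  proof
    assume *: "\<forall>g\<in>polys_below k. galois_inner p l (enc g) (enc f) = 0"
    then have eq: "tangent f ^ P * tangent g + (\<theta> - \<delta>) * coeff f (k - 1) ^ P * coeff g (k - 1)
        + (\<Sum>a\<in>T. (\<theta> - 1) * poly f a ^ P * poly g a) = 0" if "g \<in> polys_below k" for g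
      using inner[OF that f] that by simp
    note indep = functionals_independent[OF finite[of T] T eq]
    \<comment> \<open>The value of \<open>\<delta>\<close> is 0 or 1, and \<open>\<theta>\<close>
      avoids both.\<close>
    have "\<theta> - \<delta> \<noteq> 0" using \<theta> by (simp add: \<delta>_def)
    then have top: "coeff f (k - 1) = 0" using indep(2) by simp
    have "tangent f = 0" using indep(1) by simp
    then have top': "coeff f (k - 2) = 0" using top by (simp add: tangent_def)
    have "coeff f i = 0" if "i \<ge> k - 2" for i
    proof -
      from that consider "i = k - 2" | "i = k - 1" | "i \<ge> k" by linarith
      then show ?thesis using top top' polys_belowD[OF f] by cases auto
    qed
    moreover have "poly f a = 0" if "a \<in> T" for a
      using indep(3)[OF _ that] \<theta> by simp
    ultimately show "f \<in> ?F" by (simp add: polys_below_def)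
  next
    assume *: "f \<in> ?F"
    then have "coeff f (k - 1) = 0" "coeff f (k - 2) = 0" by (simp_all add: polys_below_def)
    then have "tangent f = 0" "coeff f (k - 1) = 0" by (simp_all add: tangent_def)
    with * show "\<forall>g\<in>polys_below k. galois_inner p l (enc g) (enc f) = 0"
      using inner[OF _ f] by (simp add: zero_power[OF P(2)])
  qed
  then have "enc f \<in> galois_dual p l code \<longleftrightarrow> f \<in> ?F" if "f \<in> polys_below k" for f
    using that by (simp add: galois_dual_def code_def)
  with F show ?thesis unfolding galois_hull_def code_def by auto
qed

section \<open>Dimension and minimum distance of the Euclidean dual\<close>

lemma euclidean_dual_code_iff:
  "x \<in> euclidean_dual code \<longleftrightarrow>
    (\<forall>f\<in>polys_below k. x $ inv \<phi> None * tangent f + x $ inv \<phi> (Some None) * b * coeff f (k - 1)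
      + (\<Sum>a\<in>UNIV. x $ inv \<phi> (Some (Some a)) * v a * poly f a) = 0)"
proof -
  have "(\<Sum>i\<in>UNIV. enc f $ i * x $ i) = x $ inv \<phi> None * tangent f
      + x $ inv \<phi> (Some None) * b * coeff f (k - 1)
      + (\<Sum>a\<in>UNIV. x $ inv \<phi> (Some (Some a)) * v a * poly f a)" for f
    using sum_positions[of "\<lambda>z. col z f * x $ inv \<phi> z"] bij_\<phi>
    by (simp add: bij_is_inj mult_ac)
  then show ?thesis by (simp add: euclidean_dual_def code_def)
qed

text \<open>A dual word is a linear relation among the column functionals, and evaluations at up to
  \<open>k\<close> points admit only the trivial one.\<close>

lemma euclidean_dual_supported_on_points:
  assumes x: "x \<in> euclidean_dual code" and A: "card A \<le> k"
    and zero: "\<And>i. \<phi> i \<notin> Some ` Some ` A \<Longrightarrow> x $ i = 0"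
  shows "x = 0"
proof -
  have outside: "x $ inv \<phi> z = 0" if "z \<notin> Some ` Some ` A" for z
    using zero[of "inv \<phi> z"] that bij_\<phi> by (simp add: bij_is_surj surj_f_inv_f)
  have z: "x $ inv \<phi> None = 0" "x $ inv \<phi> (Some None) = 0"
    "a \<notin> A \<Longrightarrow> x $ inv \<phi> (Some (Some a)) = 0" for a
    by (simp_all add: outside image_iff)
  have "(\<Sum>a\<in>A. x $ inv \<phi> (Some (Some a)) * v a * poly f a) = 0" if "f \<in> polys_below k" for f
  proof -
    have "(\<Sum>a\<in>A. x $ inv \<phi> (Some (Some a)) * v a * poly f a)
        = (\<Sum>a\<in>UNIV. x $ inv \<phi> (Some (Some a)) * v a * poly f a)"
      by (rule sum.mono_neutral_left) (auto simp: z)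
    then show ?thesis using x that by (auto simp: euclidean_dual_code_iff z)
  qed
  from evaluations_independent[OF finite A _ this]
  have A_zero: "x $ inv \<phi> (Some (Some a)) = 0" if "a \<in> A" for a
    using that v_nonzero[of a] by auto
  have *: "x $ inv \<phi> z = 0" for z
  proof (cases z)
    case (Some y)
    then show ?thesis using z(2) z(3) A_zero by (cases y) blast+
  qed (simp add: z(1))
  have "x $ i = 0" for i
    using *[of "\<phi> i"] bij_\<phi> by (simp add: bij_is_inj)
  then show ?thesis by (simp add: vec_eq_iff)
qed

text \<open>Any fewer than \<open>k\<close> columns are independent. The support of a relation among
  them is first confined to the field points, where evaluations are already known to be
  independent.\<close>

lemma weight_euclidean_dual:
  assumes x: "x \<in> euclidean_dual code" "x \<noteq> 0"
  shows "k \<le> card {i. x $ i \<noteq> 0}"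
proof (rule ccontr)
  define X where "X z = x $ inv \<phi> z" for z
  have X: "x $ i = X (\<phi> i)" for i
    using bij_\<phi> by (simp add: X_def bij_is_inj)
  define A where "A = {a. X (Some (Some a)) \<noteq> 0}"
  have sub: "Some ` Some ` A \<subseteq> {z. X z \<noteq> 0}" by (auto simp: A_def)
  assume "\<not> k \<le> card {i. x $ i \<noteq> 0}"
  then have less: "card {z. X z \<noteq> 0} < k"
    unfolding X using card_positions[of "\<lambda>z. X z \<noteq> 0"] by simp
  have cA: "card A = card (Some ` Some ` A)" by (simp add: card_image)
  also have "\<dots> \<le> card {z. X z \<noteq> 0}" by (intro card_mono sub) simp
  finally have "card A < k" using less by simp
  have "{z. X z \<noteq> 0} = Some ` Some ` A"
  proof (cases "card A \<le> k - 2")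
    case True
    have "X None * tangent f + X (Some None) * b * coeff f (k - 1)
        + (\<Sum>a\<in>A. X (Some (Some a)) * v a * poly f a) = 0" if "f \<in> polys_below k" for f
    proof -
      have "(\<Sum>a\<in>A. X (Some (Some a)) * v a * poly f a)
          = (\<Sum>a\<in>UNIV. X (Some (Some a)) * v a * poly f a)"
        by (rule sum.mono_neutral_left) (auto simp: A_def)
      then show ?thesis using x that by (auto simp: euclidean_dual_code_iff X_def)
    qed
    note indep = functionals_independent[OF finite True this]
    have "X None = 0" "X (Some None) = 0" using indep(1,2) b_nonzero by auto
    then show ?thesis
      unfolding A_def by (auto simp: image_iff) (metis not_Some_eq)
  next
    \<comment> \<open>Here \<open>k - 1\<close> field points already exhaust the support.\<close>
    case False
    then have "card {z. X z \<noteq> 0} \<le> card (Some ` Some ` A)" using cA less by linarith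
    from card_seteq[OF finite sub this] show ?thesis by (rule sym)
  qed
  then have "X z = 0" if "z \<notin> Some ` Some ` A" for z using that by blast
  then have "x = 0"
    using \<open>card A < k\<close> by (intro euclidean_dual_supported_on_points[OF x(1), of A]) (simp_all add: X)
  with x(2) show False by contradiction
qed

text \<open>Evaluations at the \<open>k\<close> points of \<open>A\<close> form a basis of the
  functionals on \<open>polys_below k\<close>, so every other column is a combination of them. Hence
  entries outside \<open>A\<close> can be prescribed freely, and these positions form an information
  set of the dual.\<close>

lemma euclidean_dual_extend:
  assumes A: "card A = k"
  obtains x where "x \<in> euclidean_dual code" "\<And>i. \<phi> i \<notin> Some ` Some ` A \<Longrightarrow> x $ i = y $ i"
proof
  define J where "J = {i. \<phi> i \<notin> Some ` Some ` A}"
  \<comment> \<open>Only meaningful outside \<open>J\<close>, where \<open>\<phi> i\<close> is a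
    field point.\<close>
  define pt where "pt i = the (the (\<phi> i))" for i
  \<comment> \<open>The contribution of the prescribed entries when tested on the Lagrange
    polynomial of \<open>a\<close>; the entry at \<open>a\<close> has to cancel it.\<close>
  define r where "r a = (\<Sum>j\<in>J. y $ j * col (\<phi> j) (lagrange_basis A a))" for a
  define x where "x = (\<chi> i. if i \<in> J then y $ i else - r (pt i) / v (pt i))"
  show "x $ i = y $ i" if "\<phi> i \<notin> Some ` Some ` A" for i
    using that by (simp add: x_def J_def)
  have pt: "\<phi> i = Some (Some (pt i))" "pt i \<in> A" if "i \<in> - J" for i
  proof -
    from that obtain a where "\<phi> i = Some (Some a)" "a \<in> A" unfolding J_def by blast
    then show "\<phi> i = Some (Some (pt i))" "pt i \<in> A" by (simp_all add: pt_def)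
  qed
  have \<phi>_inv: "\<phi> (inv \<phi> z) = z" for z using bij_\<phi> by (simp add: bij_is_surj surj_f_inv_f)
  have bij: "bij_betw pt (- J) A"
  proof (rule bij_betw_byWitness[where f' = "\<lambda>a. inv \<phi> (Some (Some a))"])
    show "\<forall>i\<in>- J. inv \<phi> (Some (Some (pt i))) = i"
      using bij_\<phi> by (simp add: bij_is_inj flip: pt(1))
    show "\<forall>a\<in>A. pt (inv \<phi> (Some (Some a))) = a" by (simp add: pt_def \<phi>_inv)
    show "(\<lambda>a. inv \<phi> (Some (Some a))) ` A \<subseteq> - J" by (auto simp: J_def \<phi>_inv)
    show "pt ` (- J) \<subseteq> A" using pt(2) by blast
  qed
  have "(\<Sum>i\<in>UNIV. col (\<phi> i) f * x $ i) = 0" if f: "f \<in> polys_below k" for f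
  proof -
    have "(\<Sum>i\<in>-J. col (\<phi> i) f * x $ i) = (\<Sum>i\<in>-J. - (poly f (pt i) * r (pt i)))"
    proof (rule sum.cong)
      fix i assume i: "i \<in> - J"
      then have "col (\<phi> i) f = v (pt i) * poly f (pt i)" using pt(1)[OF i] by (metis col.simps(3))
      with i show "col (\<phi> i) f * x $ i = - (poly f (pt i) * r (pt i))"
        by (simp add: x_def v_nonzero)
    qed simp
    also have "\<dots> = (\<Sum>a\<in>A. - (poly f a * r a))"
      by (rule sum.reindex_bij_betw[OF bij])
    \<comment> \<open>By linearity, the Lagrange polynomials recombine to \<open>f\<close> inside
      the columns of \<open>J\<close>.\<close>
    also have "\<dots> = - (\<Sum>j\<in>J. y $ j * col (\<phi> j) (\<Sum>a\<in>A. smult (poly f a) (lagrange_basis A a)))"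
      unfolding col_sum col_smult r_def sum_distrib_left sum_negf
      by (subst sum.swap) (simp add: mult_ac)
    also have "(\<Sum>a\<in>A. smult (poly f a) (lagrange_basis A a)) = f"
      using f A by (intro lagrange_expansion) auto
    also have "(\<Sum>j\<in>J. y $ j * col (\<phi> j) f) = (\<Sum>i\<in>J. col (\<phi> i) f * x $ i)"
      by (rule sum.cong) (simp_all add: x_def)
    finally show ?thesis
      using sum.union_disjoint[of J "- J" "\<lambda>i. col (\<phi> i) f * x $ i"] by simp
  qed
  then show "x \<in> euclidean_dual code"
    by (simp add: euclidean_dual_def code_def)
qed

lemma dim_euclidean_dual: "vec.dim (euclidean_dual code) = CARD('a) + 2 - k"
proof -
  obtain A :: "'a set" where A: "card A = k"
    using obtain_subset_with_card_n[OF k_le] by metis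
  let ?J = "{i. \<phi> i \<notin> Some ` Some ` A}"
  have "vec.dim (euclidean_dual code) = card ?J"
  proof (rule dim_information_set[OF subspace_euclidean_dual])
    show "x = 0" if "x \<in> euclidean_dual code" "\<forall>i\<in>?J. x $ i = 0" for x
      using euclidean_dual_supported_on_points[OF that(1), of A] A that(2) by simp
    show "\<exists>x\<in>euclidean_dual code. \<forall>i\<in>?J. x $ i = y $ i" for y
      using euclidean_dual_extend[OF A, of y] by (metis mem_Collect_eq)
  qed
  also have "\<dots> = card (- (Some ` Some ` A))"
    unfolding Compl_eq by (rule card_positions)
  finally show ?thesis by (simp add: card_complement card_image A)
qed

text \<open>A dual word of weight at most \<open>k\<close> is the relation expressing the tangent
  column by the \<open>k - 1\<close> points of \<open>S\<close>. It is found by prescribing 1 at the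
  tangent and 0 at infinity and at the points outside \<open>S\<close> and one auxiliary point
  \<open>a\<close>, which completes \<open>S\<close> to \<open>k\<close> points.\<close>

lemma min_dist_euclidean_dual:
  assumes S: "card S = k - 1" and c: "c = - coeff (root_poly S) (k - 2)"
  shows "min_dist (euclidean_dual code) = k"
proof -
  have "S \<noteq> UNIV" using S k_ge k_le by auto
  then obtain a where a: "a \<notin> S" by blast
  have aS: "card (insert a S) = k" using S a k_ge by simp
  obtain x where x: "x \<in> euclidean_dual code"
    "\<And>i. \<phi> i \<notin> Some ` Some ` insert a S \<Longrightarrow> x $ i = axis (inv \<phi> None) 1 $ i"
    using euclidean_dual_extend[OF aS] by metis
  have \<phi>_inv: "\<phi> (inv \<phi> z) = z" for z using bij_\<phi> by (simp add: bij_is_surj surj_f_inv_f)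
  define X where "X z = x $ inv \<phi> z" for z
  have X: "x $ i = X (\<phi> i)" for i
    using bij_\<phi> by (simp add: X_def bij_is_inj)
  have X0: "X z = (if z = None then 1 else 0)" if "z \<notin> Some ` Some ` insert a S" for z
  proof -
    have "inv \<phi> z = inv \<phi> None \<longleftrightarrow> z = None" using \<phi>_inv by metis
    then show ?thesis using x(2)[of "inv \<phi> z"] that by (simp add: X_def axis_def \<phi>_inv)
  qed
  \<comment> \<open>Testing the relation on \<open>root_poly S\<close>, which the tangent kills and
    which vanishes on \<open>S\<close>, leaves only the term at \<open>a\<close>.\<close>
  have "X (Some (Some a)) = 0"
  proof -
    let ?g = "root_poly S"
    have g: "?g \<in> polys_below k" using root_poly_in_polys_below[of S k] S k_ge by simp
    have "coeff ?g (k - 1) = 1" using coeff_root_poly_card[of S] S by simp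
    then have "tangent ?g = 0" unfolding tangent_def by (simp add: c)
    moreover have "X (Some None) = 0" using X0[of "Some None"] by auto
    ultimately have "(\<Sum>d\<in>UNIV. X (Some (Some d)) * v d * poly ?g d) = 0"
      using x(1) g by (auto simp: euclidean_dual_code_iff X_def)
    also have "(\<Sum>d\<in>UNIV. X (Some (Some d)) * v d * poly ?g d)
        = (\<Sum>d\<in>{a}. X (Some (Some d)) * v d * poly ?g d)"
    proof (rule sum.mono_neutral_right)
      show "\<forall>d\<in>UNIV - {a}. X (Some (Some d)) * v d * poly ?g d = 0"
      proof
        fix d assume "d \<in> UNIV - {a}"
        then show "X (Some (Some d)) * v d * poly ?g d = 0"
          using X0[of "Some (Some d)"] poly_root_poly_eq_0_iff[of S d] by (cases "d \<in> S") auto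
      qed
    qed auto
    finally show ?thesis using a v_nonzero by (simp add: poly_root_poly_eq_0_iff)
  qed
  then have "X z = 0" if "z \<notin> insert None (Some ` Some ` S)" for z
    using that X0[of z] by (cases "z = Some (Some a)") auto
  then have "{z. X z \<noteq> 0} \<subseteq> insert None (Some ` Some ` S)" by blast
  then have "card {z. X z \<noteq> 0} \<le> card (insert None (Some ` Some ` S))"
    by (intro card_mono) auto
  also have "\<dots> = k" using S k_ge by (simp add: card_insert_if card_image image_iff)
  finally have "card {i. x $ i \<noteq> 0} \<le> k"
    unfolding X using card_positions[of "\<lambda>z. X z \<noteq> 0"] by simp
  moreover have "x \<noteq> 0" using X0[of None] by (auto simp: X_def)
  ultimately show ?thesis
    using min_dist_eqI[OF subspace_euclidean_dual x(1)] weight_euclidean_dual by blast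
qed

end


section \<open>Choice of the column multipliers\<close>

theorem mainTheorem15:
  fixes p e q l k h :: nat
  assumes "prime p" and "q = p ^ e" and "q > 4"
    and "CARD('a::{field,finite}) = q"
    and "CARD('n::finite) = q + 2"
    and "l > 0" and "2 * l dvd e"
    and "3 \<le> k" and "real k \<le> 1 + (real q - 1) / (real p ^ l + 1)"
    and "h \<le> k - 2"
  shows "\<exists>C :: ('a ^ 'n) set.
           is_linear_code C (q + 2) k (q + 2 - k) \<and> AMDS C \<and>
           vec.dim (galois_hull p l C) = h \<and> NMDS C"
proof -
  define P where "P = p ^ l"
  have "p \<ge> 2" using prime_ge_2_nat[OF assms(1)] .
  then have P: "P \<ge> 2" using self_le_power[of p l] assms(6) by (simp add: P_def)
  have "real (k - 1) \<le> (real q - 1) / (real P + 1)"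
    using assms(8,9) by (simp add: P_def of_nat_diff)
  then have "real (k - 1) * (real P + 1) \<le> real q - 1"
    by (simp add: pos_le_divide_eq)
  then have "real ((k - 1) * (P + 1)) \<le> real (q - 1)"
    using assms(3) by (simp only: of_nat_mult of_nat_add of_nat_1)
  then have deg: "(k - 1) * (P + 1) \<le> CARD('a) - 1" using assms(4) by linarith
  have "k - 1 \<le> (k - 1) * (P + 1)" by simp
  with deg assms(3,4,8) have k_le: "k \<le> CARD('a)" by linarith
  \<comment> \<open>Needed to turn divisibility into \<open>2 * l \<le> e\<close>, as every number
    divides 0.\<close>
  have "e \<noteq> 0" using assms(2,3) by (cases "e = 0") simp_all
  then have "2 * l \<le> e" using assms(7) by (simp add: dvd_imp_le)
  then have "P ^ 2 \<le> q"
    using \<open>p \<ge> 2\<close> by (simp add: P_def assms(2) power_increasing mult.commute flip: power_mult)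
  \<comment> \<open>For \<open>P = 2\<close> this is exactly q > 4; for larger \<open>P\<close> it
    follows from \<open>3 * P \<le> P ^ 2 \<le> q\<close>.\<close>
  then have "P + 1 < CARD('a) - 1"
  proof (cases "P = 2")
    case False
    then have "3 * P \<le> P ^ 2" using P by (simp add: power2_eq_square)
    with \<open>P ^ 2 \<le> q\<close> False P assms(4) show ?thesis by linarith
  qed (use assms(3,4) in simp)
  then obtain b :: 'a where b: "b \<noteq> 0" "b ^ (P + 1) \<noteq> 1"
    using exists_power_neq_1[of "P + 1"] by auto
  \<comment> \<open>Vanishing at \<open>k - 2 - h\<close> points cuts the space of polynomials of
    degree below \<open>k - 2\<close> down to dimension \<open>h\<close>.\<close>
  obtain T :: "'a set" where T: "card T = k - 2 - h"
    using obtain_subset_with_card_n[of "k - 2 - h" "UNIV :: 'a set"] k_le by (metis diff_le_self le_trans)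
  obtain S :: "'a set" where S: "card S = k - 1"
    using obtain_subset_with_card_n[of "k - 1" "UNIV :: 'a set"] k_le by (metis diff_le_self le_trans)
  \<comment> \<open>By Vieta, this is the sum of the elements of \<open>S\<close>; both minimum
    distances rest on this choice.\<close>
  define c where "c = - coeff (root_poly S) (k - 2)"
  define v where "v a = (if a \<in> T then b else 1)" for a
  have "CARD('n) = CARD('a option option)" using assms(4,5) by simp
  then obtain \<phi> :: "'n \<Rightarrow> 'a option option" where \<phi>: "bij \<phi>"
    using finite_same_card_bij[of "UNIV :: 'n set" "UNIV :: 'a option option set"] by auto
  interpret tangent_code \<phi> v b c k
    by unfold_locales (use \<phi> b(1) assms(8) k_le in \<open>auto simp: v_def\<close>)
  have code: "is_linear_code code CARD('n) k (q + 2 - k)"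
    using subspace_code dim_code min_dist_code[OF S c_def] assms(4) by (simp add: is_linear_code_def)
  have dual: "is_linear_code (euclidean_dual code) CARD('n) (q + 2 - k) k"
    using subspace_euclidean_dual dim_euclidean_dual min_dist_euclidean_dual[OF S c_def] assms(4)
    by (simp add: is_linear_code_def)
  have amds: "AMDS code"
    unfolding AMDS_def using code k_le assms(4,5) by (intro exI[of _ k] exI[of _ "q + 2 - k"]) auto
  have "AMDS (euclidean_dual code)"
    unfolding AMDS_def using dual k_le assms(4,5) by (intro exI[of _ k] exI[of _ "q + 2 - k"]) auto
  have "galois_hull p l code = enc ` {f. f \<in> polys_below (k - 2) \<and> (\<forall>a\<in>T. poly f a = 0)}"
    by (rule galois_hull_code[OF P_def _ deg, where \<theta> = "b ^ (P + 1)"])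
      (use P b T in \<open>auto simp: v_def\<close>)
  moreover have "card T + h = k - 2" using T assms(10) by linarith
  ultimately have "vec.dim (galois_hull p l code) = h"
    using dim_enc_vanishing[OF _ refl, of T h] k_le by simp
  with code amds \<open>AMDS (euclidean_dual code)\<close> assms(5) show ?thesis
    unfolding NMDS_def by (intro exI[of _ code]) simp
qed

end
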